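(* If $I$ is a summable ideal on $\omega$, then the space $N_{I^*}$ has the bounded Josefson--Nissenzweig property (BJNP).
   Context: For $S\subseteq\wp(\omega)$, $S^*=\{A\subseteq\omega: \omega\setminus A\in S\}$. An ideal on $\omega$ is a family $I$ such that $I^*$ is a proper filter. An ideal $I$ on $\omega$ is summable if there is a function $f:\omega\to[0,\infty)$ such that $I=\operatorname{Exh}(\varphi_f)$, where $\varphi_f(A)=\sum_{n\in A}f(n)$ and $\operatorname{Exh}(\varphi)=\{A\subseteq\omega:\lim_{n\to\infty}\varphi(A\setminus[0,n])=0\}$; equivalently, $I=\{A\subseteq\omega:\sum_{n\in A}f(n)<\infty\}$. For a free filter $F$ on $\omega$ (i.e. one with $\bigcap F=\emptyset$), $N_F=\omega\cup\{p_F\}$, $p_F\notin\omega$, with the topology in which every point of $\omega$ is isolated and the open neighborhoods of $p_F$ are exactly the sets $A\cup\{p_F\}$ with $A\in F$. A finitely supported measure on a Tychonoff space $X$ is $\mu=\sum_{i=1}^n\alpha_i\delta_{x_i}$ with distinct $x_i\in X$ and $\alpha_i\in\mathbb{R}\setminus\{0\}$; $\|\mu\|=\sum_i|\alpha_i|$, $\mu(f)=\sum_i\alpha_i f(x_i)$. $X$ has the BJNP if there is a sequence $\langle\mu_n: n\in\omega\rangle$ of finitely supported measures on $X$ with $\|\mu_n\|=1$ for all $n$ and $\mu_n(f)\to0$ for every bounded continuous $f:X\to\mathbb{R}$. *)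

theory Defs
  imports "HOL-Analysis.Analysis" "HOL-Library.Poly_Mapping"
begin

subsection \<open>Filters and ideals on the natural numbers, as families of sets\<close>

definition dual_family :: "nat set set \<Rightarrow> nat set set" where
  "dual_family S = {A. UNIV - A \<in> S}"

definition proper_filter :: "nat set set \<Rightarrow> bool" where
  "proper_filter F \<longleftrightarrow> is_filter (\<lambda>P. Collect P \<in> F) \<and> {} \<notin> F"

definition free_filter :: "nat set set \<Rightarrow> bool" where
  "free_filter F \<longleftrightarrow> proper_filter F \<and> \<Inter>F = {}"

definition ideal_on_omega :: "nat set set \<Rightarrow> bool" where
  "ideal_on_omega I \<longleftrightarrow> proper_filter (dual_family I)"

definition Exh :: "(nat set \<Rightarrow> ennreal) \<Rightarrow> nat set set" where
  "Exh \<phi> = {A. (\<lambda>n. \<phi> (A - {0..n})) \<longlonglongrightarrow> 0}"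

text \<open>The sum is taken in \<open>[0, \<infinity>]\<close>, so it exists for every set of indices.\<close>

definition sum_submeasure :: "(nat \<Rightarrow> real) \<Rightarrow> nat set \<Rightarrow> ennreal" where
  "sum_submeasure f A = (\<Sum>\<^sub>\<infinity>n\<in>A. ennreal (f n))"

definition summable_ideal :: "nat set set \<Rightarrow> bool" where
  "summable_ideal I \<longleftrightarrow>
     ideal_on_omega I \<and> (\<exists>f. (\<forall>n. 0 \<le> f n) \<and> I = Exh (sum_submeasure f))"

lemma proper_filter_iff:
  "proper_filter F \<longleftrightarrow>
     UNIV \<in> F \<and> {} \<notin> F \<and> (\<forall>A\<in>F. \<forall>B\<in>F. A \<inter> B \<in> F) \<and> (\<forall>A\<in>F. \<forall>B. A \<subseteq> B \<longrightarrow> B \<in> F)"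
proof
  assume "proper_filter F"
  then interpret is_filter "\<lambda>P. Collect P \<in> F"
    by (simp add: proper_filter_def)
  have "A \<inter> B \<in> F" if "A \<in> F" "B \<in> F" for A B
    using conj[of "\<lambda>x. x \<in> A" "\<lambda>x. x \<in> B"] that by (simp add: Int_def)
  moreover have "B \<in> F" if "A \<in> F" "A \<subseteq> B" for A B
    using mono[of "\<lambda>x. x \<in> A" "\<lambda>x. x \<in> B"] that by auto
  ultimately show "UNIV \<in> F \<and> {} \<notin> F \<and> (\<forall>A\<in>F. \<forall>B\<in>F. A \<inter> B \<in> F) \<and>
      (\<forall>A\<in>F. \<forall>B. A \<subseteq> B \<longrightarrow> B \<in> F)"
    using True \<open>proper_filter F\<close> by (auto simp: proper_filter_def)
next
  assume r: "UNIV \<in> F \<and> {} \<notin> F \<and> (\<forall>A\<in>F. \<forall>B\<in>F. A \<inter> B \<in> F) \<and>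
      (\<forall>A\<in>F. \<forall>B. A \<subseteq> B \<longrightarrow> B \<in> F)"
  have "is_filter (\<lambda>P. Collect P \<in> F)"
  proof
    show "Collect (\<lambda>x. True) \<in> F" using r by simp
    show "Collect (\<lambda>x. P x \<and> Q x) \<in> F" if "Collect P \<in> F" "Collect Q \<in> F" for P Q
      using r that by (simp add: Collect_conj_eq)
    show "Collect Q \<in> F" if "\<forall>x. P x \<longrightarrow> Q x" "Collect P \<in> F" for P Q
      using r that by (meson Collect_mono)
  qed
  then show "proper_filter F" using r by (simp add: proper_filter_def)
qed

lemma summable_ideal_dual_free:
  assumes "summable_ideal I"
  shows "free_filter (dual_family I)"
proof -
  obtain f where I: "I = Exh (sum_submeasure f)" and p: "proper_filter (dual_family I)"
    using assms by (auto simp: summable_ideal_def ideal_on_omega_def)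
  have "UNIV - {k} \<in> dual_family I" for k
  proof -
    have "(\<lambda>n. sum_submeasure f ({k} - {0..n})) \<longlonglongrightarrow> 0"
    proof (rule tendsto_eventually)
      show "\<forall>\<^sub>F n in sequentially. sum_submeasure f ({k} - {0..n}) = 0"
        using eventually_ge_at_top[of k]
      proof eventually_elim
        case (elim n)
        then have "{k} - {0..n} = {}" by auto
        then show ?case by (simp add: sum_submeasure_def)
      qed
    qed
    moreover have "UNIV - (UNIV - {k}) = {k}" by auto
    ultimately show ?thesis by (simp add: dual_family_def I Exh_def)
  qed
  then have "\<Inter>(dual_family I) = {}" by blast
  with p show ?thesis by (simp add: free_filter_def)
qed


subsection \<open>The space \<open>N\<^sub>F\<close>\<close>

text \<open>The point \<open>Some n\<close> stands for the natural number \<open>n\<close>, and \<open>None\<close> for \<open>p\<^sub>F\<close>.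
  The family of sets below is a topology as soon as \<open>F\<close> is a filter; for free \<open>F\<close> it is the
  topology of \<open>N\<^sub>F\<close>, which is then Tychonoff.\<close>

definition N_space :: "nat set set \<Rightarrow> nat option topology" where
  "N_space F = topology (\<lambda>U. None \<in> U \<longrightarrow> {n. Some n \<in> U} \<in> F)"

lemma openin_N_space:
  assumes "proper_filter F"
  shows "openin (N_space F) U \<longleftrightarrow> (None \<in> U \<longrightarrow> {n. Some n \<in> U} \<in> F)"
proof -
  note F = assms[unfolded proper_filter_iff]
  have "istopology (\<lambda>U. None \<in> U \<longrightarrow> {n. Some n \<in> U} \<in> F)"
    unfolding istopology_def
  proof (intro conjI allI impI)
    fix S T :: "nat option set"
    assume "None \<in> S \<longrightarrow> {n. Some n \<in> S} \<in> F" "None \<in> T \<longrightarrow> {n. Some n \<in> T} \<in> F" "None \<in> S \<inter> T"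
    then show "{n. Some n \<in> S \<inter> T} \<in> F"
      using F by (simp add: Collect_conj_eq)
  next
    fix K :: "nat option set set"
    assume K: "\<forall>S\<in>K. None \<in> S \<longrightarrow> {n. Some n \<in> S} \<in> F" and "None \<in> \<Union>K"
    then obtain S where S: "S \<in> K" "None \<in> S" by blast
    with K have "{n. Some n \<in> S} \<in> F" by blast
    moreover have "{n. Some n \<in> S} \<subseteq> {n. Some n \<in> \<Union>K}" using S by blast
    ultimately show "{n. Some n \<in> \<Union>K} \<in> F" using F by blast
  qed
  then show ?thesis unfolding N_space_def by (simp only: topology_inverse')
qed

lemma topspace_N_space:
  assumes "proper_filter F"
  shows "topspace (N_space F) = UNIV"
proof -
  have "openin (N_space F) UNIV"
    using assms by (simp add: openin_N_space proper_filter_iff)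
  from openin_subset[OF this] show ?thesis by (rule top.extremum_uniqueI)
qed

lemma openin_N_space_isolated:
  assumes "proper_filter F"
  shows "openin (N_space F) {Some n}"
  using assms by (simp add: openin_N_space)

lemma openin_N_space_infinity:
  assumes "proper_filter F"
  shows "openin (N_space F) U \<and> None \<in> U \<longleftrightarrow> (\<exists>A\<in>F. U = insert None (Some ` A))"
proof
  assume U: "openin (N_space F) U \<and> None \<in> U"
  have "U = insert None (Some ` {n. Some n \<in> U})"
  proof (rule set_eqI)
    fix x show "x \<in> U \<longleftrightarrow> x \<in> insert None (Some ` {n. Some n \<in> U})"
      using U by (cases x) auto
  qed
  then show "\<exists>A\<in>F. U = insert None (Some ` A)"
    using U assms by (auto simp: openin_N_space)
next
  assume "\<exists>A\<in>F. U = insert None (Some ` A)"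
  then obtain A where A: "A \<in> F" "U = insert None (Some ` A)" by blast
  then have "{n. Some n \<in> U} = A" by auto
  with A show "openin (N_space F) U \<and> None \<in> U"
    using assms by (simp add: openin_N_space)
qed

lemma Tychonoff_N_space:
  assumes "free_filter F"
  shows "completely_regular_space (N_space F)" "Hausdorff_space (N_space F)"
proof -
  have p: "proper_filter F" and free: "\<Inter>F = {}"
    using assms by (auto simp: free_filter_def)
  note F = p[unfolded proper_filter_iff] and op = openin_N_space[OF p]
  have compl: "UNIV - {k} \<in> F" for k
  proof -
    obtain A where "A \<in> F" "k \<notin> A" using free by blast
    moreover from this have "A \<subseteq> UNIV - {k}" by blast
    moreover have "\<forall>A\<in>F. \<forall>B. A \<subseteq> B \<longrightarrow> B \<in> F" using F by simp
    ultimately show ?thesis by simp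
  qed
  have sep: "\<exists>U. openin (N_space F) U \<and> openin (N_space F) (UNIV - U) \<and> x \<in> U \<and> U \<subseteq> V"
    if V: "openin (N_space F) V" "x \<in> V" for x V
  proof (cases x)
    case None
    then show ?thesis using V by (auto simp: op intro!: exI[of _ V])
  next
    case (Some k)
    have "{n. Some n \<in> UNIV - {Some k}} = UNIV - {k}" by auto
    then have "openin (N_space F) (UNIV - {Some k})" using compl by (simp add: op)
    then show ?thesis using Some V by (auto simp: op intro!: exI[of _ "{Some k}"])
  qed
  show "completely_regular_space (N_space F)"
    unfolding completely_regular_space_def
  proof (intro allI impI)
    fix S x assume S: "closedin (N_space F) S \<and> x \<in> topspace (N_space F) - S"
    then have "openin (N_space F) (UNIV - S)" "x \<in> UNIV - S"
      by (auto simp: closedin_def topspace_N_space[OF p])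
    from sep[OF this] obtain U where U: "openin (N_space F) U" "openin (N_space F) (UNIV - U)"
      "x \<in> U" "U \<subseteq> UNIV - S" by blast
    define g :: "nat option \<Rightarrow> real" where "g = (\<lambda>y. if y \<in> U then 0 else 1)"
    have "openin (N_space F) {y. g y \<in> T}" for T
    proof -
      have "{y. g y \<in> T} = (if 0 \<in> T then U else {}) \<union> (if 1 \<in> T then UNIV - U else {})"
        by (auto simp: g_def)
      then show ?thesis using U(1,2) by (simp only: openin_Un openin_empty split: if_split) auto
    qed
    then have "continuous_map (N_space F) (top_of_set {0..1}) g"
      by (auto simp: continuous_map_def topspace_N_space[OF p] g_def)
    moreover have "g x = 0" "g ` S \<subseteq> {1}" using U by (auto simp: g_def)
    ultimately show "\<exists>f::nat option \<Rightarrow> real.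
        continuous_map (N_space F) (top_of_set {0..1}) f \<and> f x = 0 \<and> f ` S \<subseteq> {1}" by blast
  qed
  show "Hausdorff_space (N_space F)"
    unfolding Hausdorff_space_def
  proof (intro allI impI)
    fix x y assume "x \<in> topspace (N_space F) \<and> y \<in> topspace (N_space F) \<and> x \<noteq> y"
    then have "x \<noteq> y" by blast
    have "openin (N_space F) (UNIV - {y})"
    proof (cases y)
      case None then show ?thesis by (simp add: op)
    next
      case (Some k)
      have "{n. Some n \<in> UNIV - {Some k}} = UNIV - {k}" by auto
      then show ?thesis using compl Some by (simp add: op)
    qed
    from sep[OF this, of x] \<open>x \<noteq> y\<close> obtain U
      where "openin (N_space F) U" "openin (N_space F) (UNIV - U)" "x \<in> U" "U \<subseteq> UNIV - {y}"
      by blast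
    then show "\<exists>U V. openin (N_space F) U \<and> openin (N_space F) V \<and> x \<in> U \<and> y \<in> V \<and> disjnt U V"
      by (intro exI[of _ U] exI[of _ "UNIV - U"]) (auto simp: disjnt_def)
  qed
qed


subsection \<open>The bounded Josefson--Nissenzweig property\<close>

text \<open>A finitely supported measure \<open>\<Sum>i=1..n. \<alpha>\<^sub>i \<delta>(x\<^sub>i)\<close> with distinct \<open>x\<^sub>i\<close> and nonzero
  \<open>\<alpha>\<^sub>i\<close> is represented by the finitely supported function that maps \<open>x\<^sub>i\<close> to \<open>\<alpha>\<^sub>i\<close> and all
  other points to \<open>0\<close>. Its support is \<^const>\<open>Poly_Mapping.keys\<close>.\<close>

type_synonym 'a fs_measure = "'a \<Rightarrow>\<^sub>0 real"

definition fs_measure_on :: "'a topology \<Rightarrow> 'a fs_measure \<Rightarrow> bool" where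
  "fs_measure_on X \<mu> \<longleftrightarrow> Poly_Mapping.keys \<mu> \<subseteq> topspace X"

definition fs_norm :: "'a fs_measure \<Rightarrow> real" where
  "fs_norm \<mu> = (\<Sum>x\<in>Poly_Mapping.keys \<mu>. \<bar>Poly_Mapping.lookup \<mu> x\<bar>)"

definition fs_integral :: "'a fs_measure \<Rightarrow> ('a \<Rightarrow> real) \<Rightarrow> real" where
  "fs_integral \<mu> f = (\<Sum>x\<in>Poly_Mapping.keys \<mu>. Poly_Mapping.lookup \<mu> x * f x)"

definition BJNP :: "'a topology \<Rightarrow> bool" where
  "BJNP X \<longleftrightarrow>
     (\<exists>\<mu> :: nat \<Rightarrow> 'a fs_measure.
        (\<forall>n. fs_measure_on X (\<mu> n) \<and> fs_norm (\<mu> n) = 1) \<and>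
        (\<forall>f. continuous_map X euclideanreal f \<and> bounded (f ` topspace X) \<longrightarrow>
             (\<lambda>n. fs_integral (\<mu> n) f) \<longlonglongrightarrow> 0))"

end

theory Submission
  imports Defs
begin

text \<open>Let \<open>S k = \<Sum>i<k. f i\<close>. Properness of the ideal means that \<open>S\<close> is unbounded, so for large
  \<open>k\<close> one may take half the difference of the point mass at \<open>p\<^sub>F\<close> and the probability measure
  with weights \<open>f i / S k\<close> on \<open>i < k\<close>. A bounded continuous function differs from its value at
  \<open>p\<^sub>F\<close> by at least \<open>\<epsilon>\<close> only on a set of finite total weight, which is negligible
  relative to \<open>S k\<close>.\<close>

text \<open>In [0, \<infinity>] an unordered sum is the supremum of its finite partial sums.
  Together with \<open>sum_submeasure_le\<close>, this transfers bounds between real sums and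
  \<open>ennreal\<close>.\<close>

lemma sum_le_sum_submeasure:
  assumes "\<And>n. 0 \<le> f n" "finite B" "B \<subseteq> A"
  shows "ennreal (sum f B) \<le> sum_submeasure f A"
proof -
  have "ennreal (sum f B) = (\<Sum>n\<in>B. ennreal (f n))"
    using assms by simp
  also have "\<dots> \<le> sum_submeasure f A"
    unfolding sum_submeasure_def nonneg_infsum_complete[OF zero_le]
    by (rule SUP_upper) (use assms in simp)
  finally show ?thesis .
qed

lemma sum_submeasure_le:
  assumes "\<And>n. 0 \<le> f n" "\<And>B. finite B \<Longrightarrow> B \<subseteq> A \<Longrightarrow> sum f B \<le> c"
  shows "sum_submeasure f A \<le> ennreal c"
  unfolding sum_submeasure_def nonneg_infsum_complete[OF zero_le]
  by (rule SUP_least) (use assms in \<open>auto intro!: ennreal_leI\<close>)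

text \<open>Some tail of \<open>A\<close> has mass below 1, and the part cut off lies in the finite
  set \<open>{0..n}\<close>. The result is a real bound, uniform in the finite subsets of
  \<open>A\<close>.\<close>

lemma Exh_sum_submeasure_bounded:
  assumes f: "\<And>n. 0 \<le> f n" and "A \<in> Exh (sum_submeasure f)"
  obtains C where "\<And>B. finite B \<Longrightarrow> B \<subseteq> A \<Longrightarrow> sum f B \<le> C"
proof -
  have "(\<lambda>n. sum_submeasure f (A - {0..n})) \<longlonglongrightarrow> 0"
    using assms by (simp add: Exh_def)
  then have "\<forall>\<^sub>F n in sequentially. sum_submeasure f (A - {0..n}) < 1"
    by (rule order_tendstoD) simp
  then obtain n where n: "sum_submeasure f (A - {0..n}) < 1"
    by (auto simp: eventually_sequentially)
  have "sum f B \<le> sum f {0..n} + 1" if B: "finite B" "B \<subseteq> A" for B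
  proof -
    have "ennreal (sum f (B - {0..n})) \<le> sum_submeasure f (A - {0..n})"
      by (rule sum_le_sum_submeasure) (use f B in auto)
    with n have "ennreal (sum f (B - {0..n})) < 1" by (rule le_less_trans[rotated])
    then have "sum f (B - {0..n}) \<le> 1"
      by (simp add: ennreal_less_one_iff)
    moreover have "sum f B = sum f (B - {0..n}) + sum f (B \<inter> {0..n})"
      using B by (metis add.commute sum.Int_Diff)
    moreover have "sum f (B \<inter> {0..n}) \<le> sum f {0..n}"
      by (rule sum_mono2) (use f in auto)
    ultimately show ?thesis by linarith
  qed
  then show ?thesis by (rule that)
qed

text \<open>The tails are dominated by the remainders of the convergent series. It serves
  contrapositively: since a proper ideal omits \<open>UNIV\<close>, its weights cannot be
  summable.\<close>

lemma UNIV_in_Exh_sum_submeasure: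
  assumes f: "\<And>n. 0 \<le> f n" and s: "summable f"
  shows "UNIV \<in> Exh (sum_submeasure f)"
proof -
  have tail: "sum_submeasure f (UNIV - {0..n}) \<le> ennreal (suminf f - sum f {0..n})" for n
  proof (rule sum_submeasure_le[OF f])
    \<comment> \<open>Adjoining \<open>{0..n}\<close> to \<open>B\<close> gives a disjoint finite
      union, whose sum is at most the whole series.\<close>
    fix B :: "nat set" assume B: "finite B" "B \<subseteq> UNIV - {0..n}"
    then have "sum f B + sum f {0..n} = sum f (B \<union> {0..n})"
      by (intro sum.union_disjoint[symmetric]) auto
    also have "\<dots> \<le> suminf f"
      using B f s by (intro sum_le_suminf) auto
    finally show "sum f B \<le> suminf f - sum f {0..n}" by simp
  qed
  have "(\<lambda>n. suminf f - sum f {0..n}) \<longlonglongrightarrow> suminf f - suminf f"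
    using summable_LIMSEQ'[OF s] by (intro tendsto_intros) (simp add: atLeast0AtMost)
  then have "(\<lambda>n. ennreal (suminf f - sum f {0..n})) \<longlonglongrightarrow> 0"
    using tendsto_ennrealI by fastforce
  then have "(\<lambda>n. sum_submeasure f (UNIV - {0..n})) \<longlonglongrightarrow> 0"
    by (rule tendsto_sandwich[OF _ _ tendsto_const, rotated 2]) (use tail in \<open>auto intro!: always_eventually\<close>)
  then show ?thesis by (simp add: Exh_def)
qed

text \<open>Split the indices at \<open>e / 2 \<le> \<bar>h i\<bar>\<close>: the small values
  contribute at most \<open>e / 2\<close> to the mean, the large ones at most \<open>M * C\<close>
  divided by a total weight that tends to infinity.\<close>

lemma weighted_mean_tendsto_0:
  fixes f h :: "nat \<Rightarrow> real"
  assumes f: "\<And>n. 0 \<le> f n" and S: "filterlim (\<lambda>k. \<Sum>i<k. f i) at_top sequentially"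
    and M: "\<And>n. \<bar>h n\<bar> \<le> M"
    and small: "\<And>\<epsilon>. 0 < \<epsilon> \<Longrightarrow> \<exists>C. \<forall>B. finite B \<longrightarrow> B \<subseteq> {n. \<epsilon> \<le> \<bar>h n\<bar>} \<longrightarrow> sum f B \<le> C"
  shows "(\<lambda>k. (\<Sum>i<k. f i * h i) / (\<Sum>i<k. f i)) \<longlonglongrightarrow> 0"
proof (rule tendstoI)
  fix e :: real assume "0 < e"
  obtain C where C: "sum f B \<le> C" if "finite B" "B \<subseteq> {n. e / 2 \<le> \<bar>h n\<bar>}" for B
    using small[of "e / 2"] \<open>0 < e\<close> by auto
  have "0 \<le> M" using M[of 0] by linarith
  \<comment> \<open>Beyond \<open>2 * M * C / e\<close> the total weight makes \<open>M * C\<close>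
    less than \<open>e / 2\<close> times itself; beyond 0 it can be divided by.\<close>
  have "\<forall>\<^sub>F k in sequentially. max 0 (2 * M * C / e) < (\<Sum>i<k. f i)"
    using S unfolding filterlim_at_top_dense by blast
  then show "\<forall>\<^sub>F k in sequentially. dist ((\<Sum>i<k. f i * h i) / (\<Sum>i<k. f i)) 0 < e"
  proof eventually_elim
    case (elim k)
    define B where "B = {i. i < k \<and> e / 2 \<le> \<bar>h i\<bar>}"
    \<comment> \<open>The term \<open>e / 2 * f i\<close> is kept on \<open>B\<close> as well, so
      that it sums to a multiple of the full weight.\<close>
    have "\<bar>\<Sum>i<k. f i * h i\<bar> \<le> (\<Sum>i<k. e / 2 * f i + (if i \<in> B then M * f i else 0))"
    proof (rule order_trans[OF sum_abs sum_mono])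
      fix i assume "i \<in> {..<k}"
      then show "\<bar>f i * h i\<bar> \<le> e / 2 * f i + (if i \<in> B then M * f i else 0)"
        using f[of i] M[of i] \<open>0 < e\<close> mult_right_mono[of "\<bar>h i\<bar>" "e / 2" "f i"]
          mult_right_mono[of "\<bar>h i\<bar>" M "f i"]
        by (auto simp: B_def abs_mult mult.commute add_increasing)
    qed
    also have "\<dots> = e / 2 * (\<Sum>i<k. f i) + M * (\<Sum>i\<in>B. f i)"
    proof -
      have "(\<Sum>i<k. if i \<in> B then M * f i else 0) = (\<Sum>i\<in>{..<k} \<inter> B. M * f i)"
        by (simp add: sum.inter_restrict)
      also have "{..<k} \<inter> B = B" by (auto simp: B_def)
      finally show ?thesis by (simp add: sum.distrib sum_distrib_left)
    qed
    also have "\<dots> \<le> e / 2 * (\<Sum>i<k. f i) + M * C"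
      using \<open>0 \<le> M\<close> C[of B] by (auto simp: B_def intro!: mult_left_mono)
    also have "\<dots> < e * (\<Sum>i<k. f i)"
      using elim \<open>0 < e\<close> by (simp add: field_simps)
    finally show ?case
      using elim by (simp add: field_simps)
  qed
qed

lemma fs_norm_superset:
  assumes "finite K" "Poly_Mapping.keys \<mu> \<subseteq> K"
  shows "fs_norm \<mu> = (\<Sum>x\<in>K. \<bar>Poly_Mapping.lookup \<mu> x\<bar>)"
  unfolding fs_norm_def using assms by (intro sum.mono_neutral_left) (auto simp: in_keys_iff)

lemma fs_integral_superset:
  assumes "finite K" "Poly_Mapping.keys \<mu> \<subseteq> K"
  shows "fs_integral \<mu> g = (\<Sum>x\<in>K. Poly_Mapping.lookup \<mu> x * g x)"
  unfolding fs_integral_def using assms by (intro sum.mono_neutral_left) (auto simp: in_keys_iff)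

text \<open>Some weights may be zero, so the support can be smaller than the index set; the superset
  lemmas above allow summing over the whole index set all the same.\<close>

lemma fs_measure_of_weights:
  fixes w :: "nat \<Rightarrow> real"
  obtains \<mu> :: "nat option fs_measure"
  where "fs_norm \<mu> = \<bar>c\<bar> + (\<Sum>i<k. \<bar>w i\<bar>)"
    and "\<And>g. fs_integral \<mu> g = c * g None + (\<Sum>i<k. w i * g (Some i))"
proof -
  \<comment> \<open>The default value 0 of \<open>when\<close> beyond \<open>k\<close> makes
    \<open>v\<close> finitely supported, so that \<open>Abs_poly_mapping v\<close> has lookup
    \<open>v\<close>.\<close>
  define v where "v x = (case x of None \<Rightarrow> c | Some i \<Rightarrow> w i when i < k)" for x
  let ?K = "insert None (Some ` {..<k})"
  have nz: "x \<in> ?K" if "v x \<noteq> 0" for x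
    using that by (cases x) (auto simp: v_def)
  have "finite {x. v x \<noteq> 0}"
    by (rule finite_subset[of _ ?K]) (use nz in blast, simp)
  then have look: "Poly_Mapping.lookup (Abs_poly_mapping v) = v" by simp
  have K: "finite ?K" "Poly_Mapping.keys (Abs_poly_mapping v) \<subseteq> ?K"
    using nz by (simp, metis in_keys_iff look subsetI)
  have sum_K: "(\<Sum>x\<in>?K. u x) = u None + (\<Sum>i<k. u (Some i))" for u :: "nat option \<Rightarrow> real"
    by (subst sum.insert) (auto simp: sum.reindex)
  show ?thesis
  proof (rule that[of "Abs_poly_mapping v"])
    show "fs_norm (Abs_poly_mapping v) = \<bar>c\<bar> + (\<Sum>i<k. \<bar>w i\<bar>)"
      unfolding fs_norm_superset[OF K] look sum_K by (simp add: v_def)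
    show "fs_integral (Abs_poly_mapping v) g = c * g None + (\<Sum>i<k. w i * g (Some i))" for g
      unfolding fs_integral_superset[OF K] look sum_K by (simp add: v_def)
  qed
qed

text \<open>The preimage of the ball around \<open>g None\<close> is an open set containing
  \<open>None\<close>, so its trace on \<omega> lies in \<open>F\<close>.\<close>

lemma continuous_map_N_space_infinity:
  assumes F: "proper_filter F" and g: "continuous_map (N_space F) euclideanreal g" and "0 < \<epsilon>"
  shows "{n. \<bar>g (Some n) - g None\<bar> < \<epsilon>} \<in> F"
proof -
  have "openin (N_space F) {x \<in> topspace (N_space F). g x \<in> ball (g None) \<epsilon>}"
    using g by (rule openin_continuous_map_preimage) simp
  then show ?thesis
    using \<open>0 < \<epsilon>\<close> by (simp add: openin_N_space[OF F] topspace_N_space[OF F] dist_real_def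
        abs_minus_commute)
qed

theorem corollary6p10:
  fixes I :: "nat set set"
  assumes "summable_ideal I"
  shows "BJNP (N_space (dual_family I))"
proof -
  obtain f where f: "\<And>n. 0 \<le> f n" and I: "I = Exh (sum_submeasure f)"
    and F: "proper_filter (dual_family I)"
    using assms by (auto simp: summable_ideal_def ideal_on_omega_def)
  define S where "S k = (\<Sum>i<k. f i)" for k
  have "UNIV \<notin> I"
    using F by (simp add: proper_filter_def dual_family_def)
  then have "\<not> summable f"
    using UNIV_in_Exh_sum_submeasure[of f] f I by blast
  have S_top: "filterlim S at_top sequentially"
    unfolding filterlim_at_top
  proof
    fix Z
    \<comment> \<open>Otherwise \<open>Z\<close> would bound all partial sums of the nonnegative
      series, which would then converge.\<close>
    obtain m where m: "Z \<le> S m"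
      using \<open>\<not> summable f\<close> bounded_imp_summable[where a = f and B = Z] f
      unfolding S_def lessThan_Suc_atMost[symmetric] by (meson linear)
    show "\<forall>\<^sub>F k in sequentially. Z \<le> S k"
      using eventually_ge_at_top[of m]
    proof eventually_elim
      case (elim k)
      then have "S m \<le> S k" unfolding S_def using f by (intro sum_mono2) auto
      with m show ?case by simp
    qed
  qed
  then have "\<forall>\<^sub>F k in sequentially. 0 < S k"
    unfolding filterlim_at_top_dense by blast
  \<comment> \<open>\<open>S k\<close> may vanish for small \<open>k\<close>; indexing the measures
    by \<open>n + N\<close> keeps every denominator positive.\<close>
  then obtain N where N: "\<And>k. N \<le> k \<Longrightarrow> 0 < S k"
    unfolding eventually_sequentially by blast
  \<comment> \<open>The masses \<open>1/2\<close> and \<open>- f i / (2 * S k)\<close> cancel in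
    total, so the integral depends only on the differences
    \<open>g (Some i) - g None\<close>.\<close>
  have "\<exists>\<mu> :: nat option fs_measure. fs_norm \<mu> = 1 \<and>
      (\<forall>g. fs_integral \<mu> g =
        - ((\<Sum>i<n + N. f i * (g (Some i) - g None)) / S (n + N)) / 2)" for n
  proof -
    define k where "k = n + N"
    have pos: "0 < S k" using N by (simp add: k_def)
    obtain \<mu> :: "nat option fs_measure"
      where norm: "fs_norm \<mu> = \<bar>1/2\<bar> + (\<Sum>i<k. \<bar>- f i / (2 * S k)\<bar>)"
        and int: "\<And>g. fs_integral \<mu> g = 1/2 * g None + (\<Sum>i<k. - f i / (2 * S k) * g (Some i))"
      using fs_measure_of_weights[where c = "1/2" and k = k and w = "\<lambda>i. - f i / (2 * S k)"] by blast
    have "(\<Sum>i<k. \<bar>- f i / (2 * S k)\<bar>) = S k / (2 * S k)"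
      using f pos unfolding S_def[of k] by (simp add: sum_divide_distrib)
    then have "fs_norm \<mu> = 1" using norm pos by simp
    moreover have "fs_integral \<mu> g = - ((\<Sum>i<k. f i * (g (Some i) - g None)) / S k) / 2" for g
    proof -
      have "(\<Sum>i<k. - f i / (2 * S k) * g (Some i)) = - (\<Sum>i<k. f i * g (Some i)) / (2 * S k)"
        by (simp add: sum_divide_distrib sum_negf)
      moreover have "(\<Sum>i<k. f i * (g (Some i) - g None)) = (\<Sum>i<k. f i * g (Some i)) - S k * g None"
        by (simp add: S_def right_diff_distrib sum_subtractf sum_distrib_right)
      ultimately show ?thesis
        using pos by (simp add: int field_simps)
    qed
    ultimately show ?thesis by (auto simp: k_def)
  qed
  then obtain \<mu> :: "nat \<Rightarrow> nat option fs_measure"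
    where norm: "\<And>n. fs_norm (\<mu> n) = 1"
      and int: "\<And>n g. fs_integral (\<mu> n) g =
        - ((\<Sum>i<n + N. f i * (g (Some i) - g None)) / S (n + N)) / 2"
    by metis
  have "(\<lambda>n. fs_integral (\<mu> n) g) \<longlonglongrightarrow> 0"
    if g: "continuous_map (N_space (dual_family I)) euclideanreal g"
      and bdd: "bounded (g ` topspace (N_space (dual_family I)))" for g
  proof -
    obtain M where M: "\<And>x. \<bar>g x\<bar> \<le> M"
      using bdd by (auto simp: bounded_iff topspace_N_space[OF F])
    have "(\<lambda>k. (\<Sum>i<k. f i * (g (Some i) - g None)) / (\<Sum>i<k. f i)) \<longlonglongrightarrow> 0"
    proof (rule weighted_mean_tendsto_0[OF f S_top[unfolded S_def]])
      show "\<bar>g (Some n) - g None\<bar> \<le> 2 * M" for n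
        using M[of "Some n"] M[of None] by linarith
      show "\<exists>C. \<forall>B. finite B \<longrightarrow> B \<subseteq> {n. \<epsilon> \<le> \<bar>g (Some n) - g None\<bar>} \<longrightarrow> sum f B \<le> C"
        if "0 < \<epsilon>" for \<epsilon>
      proof -
        \<comment> \<open>Large deviations form the complement of a filter set, hence a member of
          \<open>I\<close>, on which the finite sums of \<open>f\<close> are bounded.\<close>
        have "UNIV - {n. \<bar>g (Some n) - g None\<bar> < \<epsilon>} = {n. \<epsilon> \<le> \<bar>g (Some n) - g None\<bar>}"
          by auto
        then have "{n. \<epsilon> \<le> \<bar>g (Some n) - g None\<bar>} \<in> Exh (sum_submeasure f)"
          using continuous_map_N_space_infinity[OF F g that] I by (simp add: dual_family_def)
        then show ?thesis
          by (rule Exh_sum_submeasure_bounded[OF f]) blast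
      qed
    qed
    \<comment> \<open>Shifting by \<open>N\<close>, negating and halving turns the weighted mean
      into the formula \<open>int\<close> for the integrals.\<close>
    from tendsto_divide[OF tendsto_minus[OF LIMSEQ_ignore_initial_segment[OF this, of N]]
        tendsto_const, of 2]
    show ?thesis by (simp add: int S_def)
  qed
  then show ?thesis
    unfolding BJNP_def fs_measure_on_def topspace_N_space[OF F]
    using norm by (intro exI[of _ \<mu>]) auto
qed

end
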